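(* Let $k\ge 2$ be an integer and let $\lambda>0$ be real. For all integers $m$ with $1\le m\le k-1$ and all integers $n$ with $m+1\le n\le k$, the $m$-th finite difference $\Delta_m(n)=\sum_{j=0}^{m}\binom{m}{j}(-1)^{j}\,p_{n-j}$ is given by $$\Delta_m(n)=\sum_{j=m+1}^{n}\binom{n-m-1}{j-m-1}\,\frac{\lambda^j}{j!},$$ and it satisfies $\Delta_m(n)>0$.
   Context: For an integer $k\ge 1$ and real $\lambda>0$, the Poisson distribution of order $k$ with parameter $\lambda$ has probability mass function $f_k(n;\lambda)=e^{-k\lambda}\sum \frac{\lambda^{n_1+\cdots+n_k}}{n_1!\cdots n_k!}$ for $n=0,1,2,\dots$, where the sum is over all tuples of nonnegative integers $(n_1,\dots,n_k)$ with $n_1+2n_2+\cdots+kn_k=n$. The scaled pmf is $p_n=h_k(n;\lambda)=e^{k\lambda}f_k(n;\lambda)=\sum_{n_1+2n_2+\cdots+kn_k=n}\frac{\lambda^{n_1+\cdots+n_k}}{n_1!\cdots n_k!}$ (the dependence on $k$ and $\lambda$ is suppressed in the notation $p_n$). *)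

theory Defs
  imports Complex_Main "HOL-Library.FuncSet"
begin

definition weighted_tuples :: "nat \<Rightarrow> nat \<Rightarrow> (nat \<Rightarrow> nat) set" where
  "weighted_tuples k n = {a \<in> {1..k} \<rightarrow>\<^sub>E UNIV. (\<Sum>i=1..k. i * a i) = n}"

lemma finite_weighted_tuples: "finite (weighted_tuples k n)"
proof (rule finite_subset)
  show "weighted_tuples k n \<subseteq> {1..k} \<rightarrow>\<^sub>E {..n}"
  proof
    fix a assume a: "a \<in> weighted_tuples k n"
    have "a i \<le> n" if i: "i \<in> {1..k}" for i
    proof -
      have "a i \<le> i * a i" using i by simp
      also have "\<dots> \<le> (\<Sum>i=1..k. i * a i)"
        using i by (intro member_le_sum) auto
      finally show ?thesis using a by (simp add: weighted_tuples_def)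
    qed
    with a show "a \<in> {1..k} \<rightarrow>\<^sub>E {..n}"
      by (auto simp: weighted_tuples_def PiE_iff)
  qed
qed (simp add: finite_PiE)

definition poisson_order_pmf :: "nat \<Rightarrow> real \<Rightarrow> nat \<Rightarrow> real" where
  "poisson_order_pmf k lam n =
     exp (- (real k * lam)) *
       (\<Sum>a\<in>weighted_tuples k n. lam ^ (\<Sum>i=1..k. a i) / (\<Prod>i=1..k. fact (a i)))"

definition scaled_pmf :: "nat \<Rightarrow> real \<Rightarrow> nat \<Rightarrow> real" where
  "scaled_pmf k lam n = exp (real k * lam) * poisson_order_pmf k lam n"

lemma scaled_pmf_eq_sum:
  "scaled_pmf k lam n =
     (\<Sum>a\<in>weighted_tuples k n. lam ^ (\<Sum>i=1..k. a i) / (\<Prod>i=1..k. fact (a i)))"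
  by (simp add: scaled_pmf_def poisson_order_pmf_def mult.assoc [symmetric] flip: exp_add)

(* The index n - j is natural-number subtraction, so this is the m-th backward
   difference only for m \<le> n. *)
definition backward_diff :: "nat \<Rightarrow> (nat \<Rightarrow> real) \<Rightarrow> nat \<Rightarrow> real" where
  "backward_diff m p n = (\<Sum>j=0..m. real (m choose j) * (-1) ^ j * p (n - j))"

end

(* For n \<le> k the bound on the part sizes is invisible, so counting tuples by weight with one
   part removed gives n p n = lam (\<Sum>i<n. (n - i) p i), whose second difference is a three-term
   recurrence.  The closed forms g m N = (\<Sum>i\<le>N. (N choose i) lam^(i+m+1) / (i+m+1)!) obey Pascal's
   rule g m (N+1) = g m N + g (m+1) N, and g 0 satisfies the recurrence, so p (N+1) = g 0 N;
   each backward difference then raises m by one. *)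
theory Submission imports Defs begin

definition tuple_weight :: "nat \<Rightarrow> real \<Rightarrow> (nat \<Rightarrow> nat) \<Rightarrow> real" where
  "tuple_weight k lam a = lam ^ (\<Sum>i=1..k. a i) / (\<Prod>i=1..k. fact (a i))"

lemma scaled_pmf_eq_tuple_weight:
  "scaled_pmf k lam n = (\<Sum>a\<in>weighted_tuples k n. tuple_weight k lam a)"
  by (simp add: scaled_pmf_eq_sum tuple_weight_def)

lemma sum_increment:
  fixes f :: "nat \<Rightarrow> nat"
  assumes "finite A" "i \<in> A"
  shows "(\<Sum>j\<in>A. c j * (f(i := Suc (f i))) j) = (\<Sum>j\<in>A. c j * f j) + c i"
  using assms by (simp add: sum.remove[of A i])

lemma prod_fact_increment:
  assumes "finite A" "i \<in> A"
  shows "(\<Prod>j\<in>A. fact ((f(i := Suc (f i))) j)) = real (Suc (f i)) * (\<Prod>j\<in>A. fact (f j))"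
  using assms by (simp add: prod.remove[of A i] mult.assoc del: of_nat_Suc)

text \<open>The power gains one factor \<open>lam\<close> and the factorial of the
  \<open>i\<close>-th entry gains the factor \<open>Suc (a i)\<close>. Kept multiplied out, so that
  this factor can absorb the multiplicity \<open>a i\<close> in a weighted sum.\<close>

lemma tuple_weight_increment:
  assumes "i \<in> {1..k}"
  shows "real (Suc (a i)) * tuple_weight k lam (a(i := Suc (a i))) = lam * tuple_weight k lam a"
proof -
  have s: "(\<Sum>j=1..k. (a(i := Suc (a i))) j) = Suc (\<Sum>j=1..k. a j)"
    using sum_increment[of "{1..k}" i "\<lambda>_. 1" a] assms by simp
  have p: "(\<Prod>j=1..k. fact ((a(i := Suc (a i))) j)) = real (Suc (a i)) * (\<Prod>j=1..k. fact (a j))"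
    using prod_fact_increment[of "{1..k}" i a] assms by simp
  show ?thesis
    unfolding tuple_weight_def s p by (simp del: of_nat_Suc)
qed

lemma weighted_tuples_increment:
  assumes "i \<in> {1..k}"
  shows "(\<lambda>a. a(i := Suc (a i))) ` weighted_tuples k n =
    {a \<in> weighted_tuples k (n + i). a i \<noteq> 0}" (is "?f ` _ = ?R")
proof
  show "?f ` weighted_tuples k n \<subseteq> ?R"
    using assms sum_increment[of "{1..k}" i "\<lambda>j. j"]
    by (auto simp: weighted_tuples_def PiE_iff extensional_def)
  show "?R \<subseteq> ?f ` weighted_tuples k n"
  proof
    fix a assume a: "a \<in> ?R"
    \<comment> \<open>Remove one part of size \<open>i\<close>; since \<open>a i\<close> is nonzero,
      the truncated subtraction is exact.\<close>
    define b where "b = a(i := a i - 1)"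
    have ab: "a = ?f b" using a by (auto simp: b_def)
    have "(\<Sum>j=1..k. j * b j) + i = n + i"
      using a sum_increment[of "{1..k}" i "\<lambda>j. j" b] assms ab
      by (simp add: weighted_tuples_def)
    then have "b \<in> weighted_tuples k n"
      using a assms by (auto simp: weighted_tuples_def PiE_iff extensional_def b_def)
    with ab show "a \<in> ?f ` weighted_tuples k n" by blast
  qed
qed

text \<open>Tuples with \<open>a i = 0\<close> contribute nothing, and every other one arises from
  exactly one tuple of weight \<open>n\<close> by adding a part of size \<open>i\<close>.\<close>

lemma sum_part_tuple_weight:
  assumes "i \<in> {1..k}"
  shows "(\<Sum>a\<in>weighted_tuples k (n + i). real (a i) * tuple_weight k lam a) =
    lam * scaled_pmf k lam n"
proof -
  have inj: "inj_on (\<lambda>a. a(i := Suc (a i))) (weighted_tuples k n)"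
    by (rule inj_onI) (metis fun_upd_same fun_upd_triv fun_upd_upd nat.inject)
  have "(\<Sum>a\<in>weighted_tuples k (n + i). real (a i) * tuple_weight k lam a) =
      (\<Sum>a\<in>{a \<in> weighted_tuples k (n + i). a i \<noteq> 0}. real (a i) * tuple_weight k lam a)"
    by (rule sum.mono_neutral_right) (auto simp: finite_weighted_tuples)
  also have "\<dots> = (\<Sum>a\<in>weighted_tuples k n. lam * tuple_weight k lam a)"
    unfolding weighted_tuples_increment[OF assms, symmetric] sum.reindex[OF inj]
    by (rule sum.cong)
      (use tuple_weight_increment[OF assms, of _ lam] in \<open>simp_all del: of_nat_Suc\<close>)
  finally show ?thesis by (simp add: scaled_pmf_eq_tuple_weight sum_distrib_left)
qed

lemma weighted_tuples_part_eq_0: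
  assumes "a \<in> weighted_tuples k n" "i \<in> {1..k}" "n < i"
  shows "a i = 0"
proof (rule ccontr)
  assume "a i \<noteq> 0"
  then have "i \<le> i * a i" by simp
  also have "\<dots> \<le> (\<Sum>j=1..k. j * a j)"
    using assms(2) by (intro member_le_sum) auto
  finally show False using assms by (simp add: weighted_tuples_def)
qed

text \<open>Inside each summand the factor \<open>n\<close> is expanded as the total weight of the
  tuple; swapping the two sums leaves one sum per part size, evaluated by
  \<open>sum_part_tuple_weight\<close>.\<close>

lemma scaled_pmf_convolution:
  assumes "n \<le> k"
  shows "real n * scaled_pmf k lam n = lam * (\<Sum>i<n. real (n - i) * scaled_pmf k lam i)"
proof -
  have "real n * scaled_pmf k lam n =
      (\<Sum>a\<in>weighted_tuples k n. (\<Sum>i=1..k. real (i * a i)) * tuple_weight k lam a)"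
    unfolding scaled_pmf_eq_tuple_weight sum_distrib_left
    by (rule sum.cong) (auto simp: weighted_tuples_def)
  also have "\<dots> = (\<Sum>i=1..k. real i * (\<Sum>a\<in>weighted_tuples k n. real (a i) * tuple_weight k lam a))"
    unfolding sum_distrib_left sum_distrib_right
    by (subst sum.swap) (simp add: mult.assoc)
  \<comment> \<open>Parts larger than \<open>n\<close> cannot occur, and \<open>n \<le> k\<close>
    makes every size up to \<open>n\<close> available: here the dependence on \<open>k\<close>
    disappears.\<close>
  also have "\<dots> = (\<Sum>i=1..n. real i * (\<Sum>a\<in>weighted_tuples k n. real (a i) * tuple_weight k lam a))"
    using assms
    by (intro sum.mono_neutral_right) (auto simp: weighted_tuples_part_eq_0 intro!: sum.neutral)
  also have "\<dots> = (\<Sum>i=1..n. real i * (lam * scaled_pmf k lam (n - i)))"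
  proof (rule sum.cong[OF refl])
    fix i assume "i \<in> {1..n}"
    then show "real i * (\<Sum>a\<in>weighted_tuples k n. real (a i) * tuple_weight k lam a) =
        real i * (lam * scaled_pmf k lam (n - i))"
      using sum_part_tuple_weight[of i k lam "n - i"] assms by simp
  qed
  also have "\<dots> = (\<Sum>i<n. real (n - i) * (lam * scaled_pmf k lam i))"
    by (rule sum.reindex_bij_witness[of _ "\<lambda>i. n - i" "\<lambda>i. n - i"]) auto
  finally show ?thesis by (simp add: sum_distrib_left mult.left_commute)
qed

lemma scaled_pmf_0: "scaled_pmf k lam 0 = 1"
proof -
  have "weighted_tuples k 0 = {\<lambda>i. if i \<in> {1..k} then 0 else undefined}"
    by (auto simp: weighted_tuples_def PiE_iff extensional_def fun_eq_iff)
  then show ?thesis by (simp add: scaled_pmf_eq_tuple_weight tuple_weight_def)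
qed

lemma scaled_pmf_1:
  assumes "1 \<le> k"
  shows "scaled_pmf k lam 1 = lam"
  using scaled_pmf_convolution[OF assms, of lam] scaled_pmf_0[of k lam] by simp

lemma scaled_pmf_increment:
  assumes "Suc n \<le> k"
  shows "real (Suc n) * scaled_pmf k lam (Suc n) =
    real n * scaled_pmf k lam n + lam * (\<Sum>i\<le>n. scaled_pmf k lam i)"
proof -
  have "(\<Sum>i<Suc n. real (Suc n - i) * scaled_pmf k lam i) =
      (\<Sum>i<Suc n. real (n - i) * scaled_pmf k lam i + scaled_pmf k lam i)"
    by (rule sum.cong) (auto simp: Suc_diff_le algebra_simps)
  \<comment> \<open>The term \<open>i = n\<close> leaves the first sum because its coefficient is
    0.\<close>
  also have "\<dots> = (\<Sum>i<n. real (n - i) * scaled_pmf k lam i) + (\<Sum>i\<le>n. scaled_pmf k lam i)"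
    by (simp add: sum.distrib lessThan_Suc_atMost[symmetric])
  finally show ?thesis
    using scaled_pmf_convolution[OF assms, of lam] scaled_pmf_convolution[of n k lam] assms
    by (simp add: distrib_left)
qed

text \<open>In the difference of two consecutive instances of \<open>scaled_pmf_increment\<close>,
  the partial sums cancel except for the term at \<open>n + 1\<close>.\<close>

lemma scaled_pmf_recurrence:
  assumes "n + 2 \<le> k"
  shows "real (n + 2) * scaled_pmf k lam (n + 2) =
    (2 * real (n + 1) + lam) * scaled_pmf k lam (n + 1) - real n * scaled_pmf k lam n"
  using scaled_pmf_increment[of n k lam] scaled_pmf_increment[of "n + 1" k lam] assms
  by (simp add: algebra_simps)

text \<open>The right-hand side of the theorem under \<open>j = i + m + 1\<close> and
  \<open>N = n - m - 1\<close>, which removes the truncated subtractions.\<close>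

definition diff_closed_form :: "real \<Rightarrow> nat \<Rightarrow> nat \<Rightarrow> real" where
  "diff_closed_form lam m N = (\<Sum>i\<le>N. real (N choose i) * lam ^ (i + m + 1) / fact (i + m + 1))"

lemma diff_closed_form_extend:
  assumes "N \<le> M"
  shows "diff_closed_form lam m N =
    (\<Sum>i\<le>M. real (N choose i) * lam ^ (i + m + 1) / fact (i + m + 1))"
  unfolding diff_closed_form_def
  by (rule sum.mono_neutral_left) (use assms in auto)

text \<open>Pascal's rule termwise: in the part with the lowered lower index, shifting
  \<open>i\<close> by one is the same as replacing \<open>m\<close> by \<open>Suc m\<close>.\<close>

lemma diff_closed_form_Suc:
  "diff_closed_form lam m (Suc N) = diff_closed_form lam m N + diff_closed_form lam (Suc m) N"
  unfolding diff_closed_form_extend[OF le_SucI[OF order_refl], of lam m N]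
  unfolding diff_closed_form_def sum.atMost_Suc_shift
  by (simp add: sum.distrib algebra_simps add_divide_distrib)

text \<open>This compares coefficients in the recurrence for \<open>diff_closed_form lam 0\<close>.
  Absorption and Pascal's rule reduce all terms to multiples of \<open>n choose s\<close>. At
  \<open>n = 0\<close> the truncated \<open>n - 1\<close> is multiplied by 0.\<close>

lemma binomial_second_difference:
  "real (n + 2) * real ((n + 1) choose (s + 1)) - 2 * real (n + 1) * real (n choose (s + 1))
    + real n * real ((n - 1) choose (s + 1)) = real (s + 2) * real (n choose s)"
proof -
  have a: "real n * real ((n - 1) choose (s + 1)) =
      (real n - real s - 1) * real (n choose (s + 1))"
  proof (cases "s + 1 \<le> n")
    case True
    then have "n - (s + 1) = n - s - 1" "real (n - (s + 1)) = real n - real s - 1"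
      by (auto simp: of_nat_diff)
    then show ?thesis
      using binomial_absorb_comp[of n "s + 1"] by (metis of_nat_mult)
  qed (simp add: binomial_eq_0)
  have b: "(real s + 1) * real (n choose (s + 1)) = (real n - real s) * real (n choose s)"
  proof (cases "s \<le> n")
    case True
    then have "real (n - s) = real n - real s" by (simp add: of_nat_diff)
    moreover have "(s + 1) * (n choose (s + 1)) = (n - s) * (n choose s)"
      using binomial_absorption[of s n] binomial_absorb_comp[of n s] by simp
    ultimately show ?thesis by (metis of_nat_1 of_nat_add of_nat_mult)
  qed (simp add: binomial_eq_0)
  have c: "real ((n + 1) choose (s + 1)) = real (n choose s) + real (n choose (s + 1))"
    by simp
  show ?thesis
    unfolding a c using b by (simp add: algebra_simps)
qed

lemma diff_closed_form_recurrence: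
  "real (n + 2) * diff_closed_form lam 0 (n + 1) =
    (2 * real (n + 1) + lam) * diff_closed_form lam 0 n - real n * diff_closed_form lam 0 (n - 1)"
proof -
  let ?t = "\<lambda>i. lam ^ (i + 1) / fact (i + 1)"
  \<comment> \<open>A common summation range lets the three closed forms be combined
    termwise.\<close>
  have e: "diff_closed_form lam 0 N = (\<Sum>i\<le>Suc n. real (N choose i) * ?t i)" if "N \<le> Suc n" for N
    using diff_closed_form_extend[OF that, of lam 0] by simp
  have "real (n + 2) * diff_closed_form lam 0 (n + 1) - 2 * real (n + 1) * diff_closed_form lam 0 n
      + real n * diff_closed_form lam 0 (n - 1) =
      (\<Sum>i\<le>Suc n. (real (n + 2) * real ((n + 1) choose i) - 2 * real (n + 1) * real (n choose i)
        + real n * real ((n - 1) choose i)) * ?t i)"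
    by (simp only: e[of "n + 1"] e[of n] e[of "n - 1"] sum_distrib_left sum.distrib sum_subtractf
        distrib_right left_diff_distrib mult.assoc le_Suc_eq Suc_eq_plus1 simp_thms
        le_SucI[OF diff_le_self] order_refl)
  \<comment> \<open>The coefficient at \<open>i = 0\<close> is
    \<open>(n + 2) - 2 * (n + 1) + n = 0\<close>; the others are reindexed by
    \<open>i = s + 1\<close>.\<close>
  also have "\<dots> = (\<Sum>s\<le>n. (real (s + 2) * real (n choose s)) * ?t (s + 1))"
    unfolding sum.atMost_Suc_shift
    using binomial_second_difference[of n] by simp
  also have "\<dots> = lam * diff_closed_form lam 0 n"
    unfolding diff_closed_form_def sum_distrib_left
  proof (rule sum.cong[OF refl])
    fix s
    have "fact (s + 1 + 1) = real (s + 2) * fact (s + 1)" by simp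
    then show "real (s + 2) * real (n choose s) * ?t (s + 1) =
        lam * (real (n choose s) * lam ^ (s + 0 + 1) / fact (s + 0 + 1))"
      by (simp add: field_simps del: fact_Suc of_nat_add of_nat_Suc)
  qed
  finally show ?thesis by (simp add: algebra_simps)
qed

lemma scaled_pmf_Suc_closed_form:
  assumes "Suc N \<le> k"
  shows "scaled_pmf k lam (Suc N) = diff_closed_form lam 0 N"
  using assms
proof (induction N rule: less_induct)
  case (less N)
  show ?case
  proof (cases N)
    case 0
    then show ?thesis using scaled_pmf_1[of k lam] less.prems by (simp add: diff_closed_form_def)
  next
    case (Suc n)
    \<comment> \<open>At \<open>n = 0\<close> the values themselves are 1 and \<open>lam\<close>,
      but both are multiplied by 0. So the two recurrences agree there too, and
      \<open>scaled_pmf_1\<close> suffices as base case.\<close>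
    have "real n * scaled_pmf k lam n = real n * diff_closed_form lam 0 (n - 1)"
      using less.IH[of "n - 1"] less.prems Suc by (cases n) auto
    moreover have "scaled_pmf k lam (n + 1) = diff_closed_form lam 0 n"
      using less.IH[of n] less.prems Suc by simp
    ultimately have "real (n + 2) * scaled_pmf k lam (n + 2) =
        real (n + 2) * diff_closed_form lam 0 (n + 1)"
      using scaled_pmf_recurrence[of n k lam] diff_closed_form_recurrence[of n lam] less.prems Suc
      by simp
    then show ?thesis using Suc by simp
  qed
qed

lemma backward_diff_Suc:
  assumes "1 \<le> n"
  shows "backward_diff (Suc m) p n = backward_diff m p n - backward_diff m p (n - 1)"
proof -
  \<comment> \<open>The added term has coefficient \<open>m choose Suc m = 0\<close>; with equal
    ranges, Pascal's rule applies termwise.\<close>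
  have "backward_diff m p n =
      (\<Sum>j\<le>Suc m. real (m choose j) * (-1) ^ j * p (n - j))"
    by (simp add: backward_diff_def atLeast0AtMost)
  then show ?thesis
    unfolding backward_diff_def atLeast0AtMost sum.atMost_Suc_shift
    by (simp add: sum.distrib sum_subtractf sum_negf algebra_simps)
qed

text \<open>Induction on \<open>m\<close> with \<open>N\<close> free: the step subtracts the values
  at \<open>N\<close> from those at \<open>Suc N\<close>, and \<open>diff_closed_form_Suc\<close>
  identifies the result.\<close>

lemma backward_diff_scaled_pmf:
  assumes "N + m + 1 \<le> k"
  shows "backward_diff m (scaled_pmf k lam) (N + m + 1) = diff_closed_form lam m N"
  using assms
proof (induction m arbitrary: N)
  case 0
  then show ?case by (simp add: backward_diff_def scaled_pmf_Suc_closed_form)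
next
  case (Suc m)
  then show ?case
    using Suc.IH[of N] Suc.IH[of "Suc N"]
    by (simp add: backward_diff_Suc diff_closed_form_Suc)
qed

lemma diff_closed_form_pos:
  assumes "lam > 0"
  shows "diff_closed_form lam m N > 0"
  unfolding diff_closed_form_def using assms
  by (intro sum_pos) auto

theorem proposition3p1:
  fixes k m n :: nat and lam :: real
  assumes "k \<ge> 2" and "lam > 0"
    and "1 \<le> m" and "m \<le> k - 1"
    and "m + 1 \<le> n" and "n \<le> k"
  shows "backward_diff m (scaled_pmf k lam) n =
           (\<Sum>j=m+1..n. real ((n - m - 1) choose (j - m - 1)) * lam ^ j / fact j)
         \<and> backward_diff m (scaled_pmf k lam) n > 0"
proof -
  define N where "N = n - m - 1"
  have n: "n = N + m + 1" using assms by (simp add: N_def)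
  have "(\<Sum>j=m+1..n. real ((n - m - 1) choose (j - m - 1)) * lam ^ j / fact j) =
      diff_closed_form lam m N"
    unfolding diff_closed_form_def
    by (rule sum.reindex_bij_witness[of _ "\<lambda>i. i + m + 1" "\<lambda>j. j - m - 1"]) (auto simp: n)
  then show ?thesis
    using backward_diff_scaled_pmf[of N m k lam] diff_closed_form_pos[OF assms(2)] assms n by simp
qed

end
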